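(* Let $d\ge1$, $m>0$, and let $E$ be one of the spaces $C_{ub}(\mathbb{R}^d)$, $C_b(\mathbb{R}^d)$, $L^\infty(\mathbb{R}^d)$. Let $A,G:E\to E$ be such that $Gv\ge0$ and $Av\ge0$ for all $0\le v\in E$, and, for some $\kappa,\varkappa>0$, $$\|Av-Aw\|_E\le\varkappa\|v-w\|_E,\qquad v,w\in E,\ v\ge0,\ w\ge0,$$ $$\|Gv-Gw\|_E\le e^{\kappa r}\|v-w\|_E,\qquad v,w\in E_r^+,\ r>0 .$$ Then, for any $T>0$ and $0\le u_0\in E$, there exists a unique nonnegative classical solution $u\in C([0,T]\to E)\cap C^1((0,T]\to E)$ to the equation $$\frac{\partial u}{\partial t}(x,t)=(Au)(x,t)-m\,u(x,t)-u(x,t)(Gu)(x,t),\qquad u(x,0)=u_0(x),$$ where $t\in(0,T]$, $x\in\mathbb{R}^d$.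
   Context: $C_{ub}(\mathbb{R}^d)$ and $C_b(\mathbb{R}^d)$ are the spaces of bounded uniformly continuous, respectively bounded continuous, real functions with the sup-norm; $L^\infty(\mathbb{R}^d)$ has the esssup-norm. Inequalities between elements of $E$ are pointwise (a.e. if $E=L^\infty$). For $r>0$, $E_r^+:=\{v\in E:0\le v\le r\}$. $(Au)(x,t)$ and $(Gu)(x,t)$ mean $(Au(\cdot,t))(x)$ and $(Gu(\cdot,t))(x)$. The operators $A$ and $G$ need not be linear. A classical solution on $[0,T]$ is a function $u\in C([0,T]\to E)\cap C^1((0,T]\to E)$ which satisfies the equation for $t\in(0,T]$ and $u(\cdot,0)=u_0$ in $E$. *)

theory Defs
  imports "HOL-Analysis.Analysis" "HOL-Probability.Essential_Supremum"
begin

section \<open>Bounded continuous functions as an ordered normed algebra\<close>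

unbundle bcontfun.lifting

instantiation bcontfun :: (topological_space, "{metric_space, order}") order
begin

lift_definition less_eq_bcontfun :: "('a \<Rightarrow>\<^sub>C 'b) \<Rightarrow> ('a \<Rightarrow>\<^sub>C 'b) \<Rightarrow> bool"
  is "\<lambda>f g. \<forall>x. f x \<le> g x" .

definition less_bcontfun :: "('a \<Rightarrow>\<^sub>C 'b) \<Rightarrow> ('a \<Rightarrow>\<^sub>C 'b) \<Rightarrow> bool"
  where "less_bcontfun f g \<longleftrightarrow> f \<le> g \<and> \<not> g \<le> f"

instance
proof
  fix f g h :: "'a \<Rightarrow>\<^sub>C 'b"
  show "f < g \<longleftrightarrow> f \<le> g \<and> \<not> g \<le> f" by (rule less_bcontfun_def)
  show "f \<le> f" by transfer simp
  show "f \<le> g \<Longrightarrow> g \<le> h \<Longrightarrow> f \<le> h" by transfer (blast intro: order_trans)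
  show "f \<le> g \<Longrightarrow> g \<le> f \<Longrightarrow> f = g" by transfer (auto intro: antisym)
qed

end

instantiation bcontfun :: (topological_space, real_normed_algebra_1) real_normed_algebra_1
begin

lift_definition one_bcontfun :: "'a \<Rightarrow>\<^sub>C 'b" is "\<lambda>_. 1"
  by (rule const_bcontfun)

lift_definition times_bcontfun :: "('a \<Rightarrow>\<^sub>C 'b) \<Rightarrow> ('a \<Rightarrow>\<^sub>C 'b) \<Rightarrow> ('a \<Rightarrow>\<^sub>C 'b)"
  is "\<lambda>f g x. f x * g x"
proof -
  fix f g :: "'a \<Rightarrow> 'b" assume fg: "f \<in> bcontfun" "g \<in> bcontfun"
  then obtain B C where B: "\<And>x. norm (f x) \<le> B" and C: "\<And>x. norm (g x) \<le> C"
    by (auto simp: bcontfun_def bounded_iff)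
  show "(\<lambda>x. f x * g x) \<in> bcontfun"
  proof (rule bcontfun_normI)
    show "continuous_on UNIV (\<lambda>x. f x * g x)"
      using fg by (auto simp: bcontfun_def intro!: continuous_intros)
    have "0 \<le> B" using B norm_ge_zero order_trans by blast
    then show "norm (f x * g x) \<le> B * C" for x
      by (intro order_trans[OF norm_mult_ineq] mult_mono B C) auto
  qed
qed

instance
proof
  fix f g h :: "'a \<Rightarrow>\<^sub>C 'b" and a :: real
  show "f * g * h = f * (g * h)" by transfer (simp add: mult.assoc)
  show "(f + g) * h = f * h + g * h" by transfer (simp add: algebra_simps)
  show "f * (g + h) = f * g + f * h" by transfer (simp add: algebra_simps)
  show "a *\<^sub>R f * g = a *\<^sub>R (f * g)" by transfer simp
  show "f * a *\<^sub>R g = a *\<^sub>R (f * g)" by transfer simp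
  show "1 * f = f" by transfer simp
  show "f * 1 = f" by transfer simp
  show "(0 :: 'a \<Rightarrow>\<^sub>C 'b) \<noteq> 1"
    by transfer (metis zero_neq_one)
  show "norm (f * g) \<le> norm f * norm g"
  proof (rule norm_bound)
    fix x
    have "norm (apply_bcontfun (f * g) x) = norm (apply_bcontfun f x * apply_bcontfun g x)"
      by transfer simp
    also have "\<dots> \<le> norm f * norm g"
      by (intro order_trans[OF norm_mult_ineq] mult_mono norm_bounded) auto
    finally show "norm (apply_bcontfun (f * g) x) \<le> norm f * norm g" .
  qed
  have one: "apply_bcontfun (1 :: 'a \<Rightarrow>\<^sub>C 'b) x = 1" for x by transfer simp
  show "norm (1 :: 'a \<Rightarrow>\<^sub>C 'b) = 1"
    using norm_bounded[of "1 :: 'a \<Rightarrow>\<^sub>C 'b"] by (intro antisym norm_bound) (simp_all add: one)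
qed

end

lifting_update bcontfun.lifting
lifting_forget bcontfun.lifting

definition C_b :: "('a::euclidean_space \<Rightarrow>\<^sub>C real) set"
  where "C_b = UNIV"

definition C_ub :: "('a::euclidean_space \<Rightarrow>\<^sub>C real) set"
  where "C_ub = {f. uniformly_continuous_on UNIV (apply_bcontfun f)}"


section \<open>Essentially bounded functions modulo equality almost everywhere\<close>

text \<open>\<^const>\<open>esssup\<close> is \<open>\<infinity>\<close> on non-measurable functions.\<close>

definition ess_norm :: "('a::euclidean_space \<Rightarrow> real) \<Rightarrow> ereal"
  where "ess_norm f = esssup lebesgue (\<lambda>x. ereal \<bar>f x\<bar>)"

definition ess_bounded :: "('a::euclidean_space \<Rightarrow> real) \<Rightarrow> bool"
  where "ess_bounded f \<longleftrightarrow> f \<in> borel_measurable lebesgue \<and> ess_norm f < \<infinity>"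

definition linf_rel :: "('a::euclidean_space \<Rightarrow> real) \<Rightarrow> ('a \<Rightarrow> real) \<Rightarrow> bool"
  where "linf_rel f g \<longleftrightarrow> ess_bounded f \<and> ess_bounded g \<and> (AE x in lebesgue. f x = g x)"

lemma ess_bounded_measurable: "ess_bounded f \<Longrightarrow> f \<in> borel_measurable lebesgue"
  by (simp add: ess_bounded_def)

lemma ess_norm_le:
  assumes "f \<in> borel_measurable lebesgue" "AE x in lebesgue. \<bar>f x\<bar> \<le> c"
  shows "ess_norm f \<le> ereal c"
  unfolding ess_norm_def using assms by (intro esssup_I) auto

lemma ess_norm_nonneg: "0 \<le> ess_norm (f :: 'a::euclidean_space \<Rightarrow> real)"
proof -
  have "AE x in lebesgue. ereal \<bar>f x\<bar> \<le> ess_norm f"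
    unfolding ess_norm_def by (rule esssup_AE)
  then have "AE x in (lebesgue :: 'a measure). 0 \<le> ess_norm f"
    by eventually_elim (meson abs_ge_zero ereal_less_eq(5) order_trans)
  moreover have "ae_filter (lebesgue :: 'a measure) \<noteq> bot"
    by (simp add: ae_filter_eq_bot_iff)
  ultimately show ?thesis by simp
qed

lemma ess_bounded_ess_norm:
  assumes "ess_bounded f"
  shows "ess_norm f = ereal (real_of_ereal (ess_norm f))"
  using assms ess_norm_nonneg[of f] unfolding ess_bounded_def
  by (cases "ess_norm f") auto

lemma ess_bounded_AE:
  assumes "ess_bounded f"
  shows "AE x in lebesgue. \<bar>f x\<bar> \<le> real_of_ereal (ess_norm f)"
proof -
  have "AE x in lebesgue. ereal \<bar>f x\<bar> \<le> ess_norm f"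
    unfolding ess_norm_def by (rule esssup_AE)
  then show ?thesis
    by (subst (asm) ess_bounded_ess_norm[OF assms]) simp
qed

lemma ess_boundedI:
  assumes "f \<in> borel_measurable lebesgue" "AE x in lebesgue. \<bar>f x\<bar> \<le> c"
  shows "ess_bounded f"
  using ess_norm_le[OF assms] assms(1) by (auto simp: ess_bounded_def)

lemma real_ess_norm_le:
  assumes "f \<in> borel_measurable lebesgue" "AE x in lebesgue. \<bar>f x\<bar> \<le> c"
  shows "real_of_ereal (ess_norm f) \<le> c"
  using ess_norm_le[OF assms] ess_bounded_ess_norm[OF ess_boundedI[OF assms]]
  by (metis ereal_less_eq(3))

lemma real_ess_norm_nonneg: "0 \<le> real_of_ereal (ess_norm f)"
  using ess_norm_nonneg by (rule real_of_ereal_pos)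

lemma ess_bounded_const: "ess_bounded (\<lambda>_. c)"
  by (rule ess_boundedI[of _ "\<bar>c\<bar>"]) auto

lemma ess_bounded_add: "ess_bounded f \<Longrightarrow> ess_bounded g \<Longrightarrow> ess_bounded (\<lambda>x. f x + g x)"
proof -
  assume f: "ess_bounded f" and g: "ess_bounded g"
  have "AE x in lebesgue. \<bar>f x + g x\<bar> \<le> real_of_ereal (ess_norm f) + real_of_ereal (ess_norm g)"
    using ess_bounded_AE[OF f] ess_bounded_AE[OF g] by eventually_elim linarith
  then show ?thesis
    by (intro ess_boundedI borel_measurable_add f[THEN ess_bounded_measurable] g[THEN ess_bounded_measurable])
qed

lemma ess_bounded_mult: "ess_bounded f \<Longrightarrow> ess_bounded g \<Longrightarrow> ess_bounded (\<lambda>x. f x * g x)"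
proof -
  assume f: "ess_bounded f" and g: "ess_bounded g"
  have "AE x in lebesgue. \<bar>f x * g x\<bar> \<le> real_of_ereal (ess_norm f) * real_of_ereal (ess_norm g)"
    using ess_bounded_AE[OF f] ess_bounded_AE[OF g]
    by eventually_elim (simp add: abs_mult mult_mono)
  then show ?thesis
    by (intro ess_boundedI borel_measurable_times f[THEN ess_bounded_measurable] g[THEN ess_bounded_measurable])
qed

lemma ess_bounded_cmult: "ess_bounded f \<Longrightarrow> ess_bounded (\<lambda>x. c * f x)"
  using ess_bounded_mult[OF ess_bounded_const] .

lemma ess_bounded_uminus: "ess_bounded f \<Longrightarrow> ess_bounded (\<lambda>x. - f x)"
  using ess_bounded_cmult[of f "-1"] by simp

lemma ess_bounded_diff: "ess_bounded f \<Longrightarrow> ess_bounded g \<Longrightarrow> ess_bounded (\<lambda>x. f x - g x)"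
  using ess_bounded_add[OF _ ess_bounded_uminus, of f g] by simp

lemma ess_norm_cong: "linf_rel f g \<Longrightarrow> ess_norm f = ess_norm g"
  unfolding ess_norm_def
  by (intro esssup_AE_cong) (auto simp: linf_rel_def dest: ess_bounded_measurable)

quotient_type (overloaded) 'a linf = "'a::euclidean_space \<Rightarrow> real" / partial: linf_rel
proof (rule part_equivpI)
  show "\<exists>f :: 'a \<Rightarrow> real. linf_rel f f"
    by (intro exI[of _ "\<lambda>_. 0"]) (simp add: linf_rel_def ess_bounded_const)
  show "symp (linf_rel :: ('a \<Rightarrow> real) \<Rightarrow> _)"
    by (auto intro!: sympI simp: linf_rel_def eq_commute)
  show "transp (linf_rel :: ('a \<Rightarrow> real) \<Rightarrow> _)"
    unfolding linf_rel_def by (intro transpI) (force elim: eventually_elim2)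
qed

instantiation linf :: (euclidean_space) order
begin

lift_definition less_eq_linf :: "'a linf \<Rightarrow> 'a linf \<Rightarrow> bool"
  is "\<lambda>f g. AE x in lebesgue. f x \<le> g x"
proof -
  fix f f' g g' :: "'a \<Rightarrow> real" assume "linf_rel f f'" "linf_rel g g'"
  then have *: "AE x in lebesgue. f x = f' x" "AE x in lebesgue. g x = g' x"
    by (auto simp: linf_rel_def)
  show "(AE x in lebesgue. f x \<le> g x) = (AE x in lebesgue. f' x \<le> g' x)"
    by (rule eventually_subst) (use * in \<open>eventually_elim, simp\<close>)
qed

definition less_linf :: "'a linf \<Rightarrow> 'a linf \<Rightarrow> bool"
  where "less_linf f g \<longleftrightarrow> f \<le> g \<and> \<not> g \<le> f"

instance
proof
  fix f g h :: "'a linf"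
  show "f < g \<longleftrightarrow> f \<le> g \<and> \<not> g \<le> f" by (rule less_linf_def)
  show "f \<le> f" by transfer simp
  show "f \<le> g \<Longrightarrow> g \<le> h \<Longrightarrow> f \<le> h"
    by transfer (force elim: eventually_elim2)
  show "f \<le> g \<Longrightarrow> g \<le> f \<Longrightarrow> f = g"
    by transfer (force simp: linf_rel_def elim: eventually_elim2)
qed

end

instantiation linf :: (euclidean_space) real_algebra_1
begin

lift_definition zero_linf :: "'a linf" is "\<lambda>_. 0"
  by (simp add: linf_rel_def ess_bounded_const)

lift_definition one_linf :: "'a linf" is "\<lambda>_. 1"
  by (simp add: linf_rel_def ess_bounded_const)

lift_definition plus_linf :: "'a linf \<Rightarrow> 'a linf \<Rightarrow> 'a linf" is "\<lambda>f g x. f x + g x"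
  unfolding linf_rel_def by (intro conjI) (auto intro: ess_bounded_add elim: eventually_elim2)

lift_definition minus_linf :: "'a linf \<Rightarrow> 'a linf \<Rightarrow> 'a linf" is "\<lambda>f g x. f x - g x"
  unfolding linf_rel_def by (intro conjI) (auto intro: ess_bounded_diff elim: eventually_elim2)

lift_definition uminus_linf :: "'a linf \<Rightarrow> 'a linf" is "\<lambda>f x. - f x"
  unfolding linf_rel_def by (intro conjI) (auto intro: ess_bounded_uminus elim: eventually_mono)

lift_definition times_linf :: "'a linf \<Rightarrow> 'a linf \<Rightarrow> 'a linf" is "\<lambda>f g x. f x * g x"
  unfolding linf_rel_def by (intro conjI) (auto intro: ess_bounded_mult elim: eventually_elim2)

lift_definition scaleR_linf :: "real \<Rightarrow> 'a linf \<Rightarrow> 'a linf" is "\<lambda>c f x. c * f x"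
  unfolding linf_rel_def by (intro conjI) (auto intro: ess_bounded_cmult elim: eventually_mono)

instance
proof
  fix f g h :: "'a linf" and a b :: real
  note eb = ess_bounded_add ess_bounded_diff ess_bounded_mult ess_bounded_cmult
    ess_bounded_uminus ess_bounded_const
  show "f + g + h = f + (g + h)"
    by transfer (auto simp: linf_rel_def algebra_simps intro!: eb)
  show "f + g = g + f"
    by transfer (auto simp: linf_rel_def algebra_simps intro!: eb)
  show "0 + f = f"
    by transfer (auto simp: linf_rel_def)
  show "- f + f = 0"
    by transfer (auto simp: linf_rel_def intro!: eb)
  show "f - g = f + - g"
    by transfer (auto simp: linf_rel_def intro!: eb)
  show "a *\<^sub>R (f + g) = a *\<^sub>R f + a *\<^sub>R g"
    by transfer (auto simp: linf_rel_def algebra_simps intro!: eb)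
  show "(a + b) *\<^sub>R f = a *\<^sub>R f + b *\<^sub>R f"
    by transfer (auto simp: linf_rel_def algebra_simps intro!: eb)
  show "a *\<^sub>R b *\<^sub>R f = (a * b) *\<^sub>R f"
    by transfer (auto simp: linf_rel_def algebra_simps intro!: eb)
  show "1 *\<^sub>R f = f"
    by transfer (auto simp: linf_rel_def)
  show "f * g * h = f * (g * h)"
    by transfer (auto simp: linf_rel_def algebra_simps intro!: eb)
  show "(f + g) * h = f * h + g * h"
    by transfer (auto simp: linf_rel_def algebra_simps intro!: eb)
  show "f * (g + h) = f * g + f * h"
    by transfer (auto simp: linf_rel_def algebra_simps intro!: eb)
  show "a *\<^sub>R f * g = a *\<^sub>R (f * g)"
    by transfer (auto simp: linf_rel_def algebra_simps intro!: eb)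
  show "f * a *\<^sub>R g = a *\<^sub>R (f * g)"
    by transfer (auto simp: linf_rel_def algebra_simps intro!: eb)
  show "1 * f = f" by transfer (auto simp: linf_rel_def)
  show "f * 1 = f" by transfer (auto simp: linf_rel_def)
  show "(0 :: 'a linf) \<noteq> 1"
    by transfer (simp add: linf_rel_def ae_filter_eq_bot_iff)
qed

end

instantiation linf :: (euclidean_space) real_normed_algebra_1
begin

lift_definition norm_linf :: "'a linf \<Rightarrow> real" is "\<lambda>f. real_of_ereal (ess_norm f)"
  by (simp add: ess_norm_cong)

definition dist_linf :: "'a linf \<Rightarrow> 'a linf \<Rightarrow> real"
  where "dist_linf f g = norm (f - g)"

definition sgn_linf :: "'a linf \<Rightarrow> 'a linf"
  where "sgn_linf f = f /\<^sub>R norm f"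

definition uniformity_linf :: "('a linf \<times> 'a linf) filter"
  where "uniformity_linf = (INF e\<in>{0 <..}. principal {(f, g). dist f g < e})"

definition open_linf :: "'a linf set \<Rightarrow> bool"
  where "open_linf S = (\<forall>f\<in>S. \<forall>\<^sub>F (f', g) in uniformity. f' = f \<longrightarrow> g \<in> S)"

instance
proof
  fix f g :: "'a linf" and a :: real
  show "dist f g = norm (f - g)" by (rule dist_linf_def)
  show "sgn f = f /\<^sub>R norm f" by (rule sgn_linf_def)
  show "uniformity = (INF e\<in>{0 <..}. principal {(f, g :: 'a linf). dist f g < e})"
    by (rule uniformity_linf_def)
  show "open S = (\<forall>f\<in>S. \<forall>\<^sub>F (f', g) in uniformity. f' = f \<longrightarrow> g \<in> S)" for S :: "'a linf set"
    by (rule open_linf_def)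
  show "norm f = 0 \<longleftrightarrow> f = 0"
  proof transfer
    fix f :: "'a \<Rightarrow> real" assume "linf_rel f f"
    then have f: "ess_bounded f" by (simp add: linf_rel_def)
    show "real_of_ereal (ess_norm f) = 0 \<longleftrightarrow> linf_rel f (\<lambda>_. 0)"
    proof
      assume "real_of_ereal (ess_norm f) = 0"
      with ess_bounded_AE[OF f] have "AE x in lebesgue. f x = 0" by simp
      with f show "linf_rel f (\<lambda>_. 0)" by (simp add: linf_rel_def ess_bounded_const)
    next
      assume "linf_rel f (\<lambda>_. 0)"
      then have "real_of_ereal (ess_norm f) \<le> 0"
        using f by (intro real_ess_norm_le) (auto simp: linf_rel_def dest: ess_bounded_measurable)
      with real_ess_norm_nonneg[of f] show "real_of_ereal (ess_norm f) = 0" by linarith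
    qed
  qed
  show "norm (f + g) \<le> norm f + norm g"
  proof transfer
    fix f g :: "'a \<Rightarrow> real" assume "linf_rel f f" "linf_rel g g"
    then have f: "ess_bounded f" and g: "ess_bounded g" by (simp_all add: linf_rel_def)
    have "AE x in lebesgue. \<bar>f x + g x\<bar> \<le> real_of_ereal (ess_norm f) + real_of_ereal (ess_norm g)"
      using ess_bounded_AE[OF f] ess_bounded_AE[OF g] by eventually_elim linarith
    then show "real_of_ereal (ess_norm (\<lambda>x. f x + g x))
        \<le> real_of_ereal (ess_norm f) + real_of_ereal (ess_norm g)"
      by (intro real_ess_norm_le ess_bounded_measurable ess_bounded_add f g)
  qed
  show "norm (f * g) \<le> norm f * norm g"
  proof transfer
    fix f g :: "'a \<Rightarrow> real" assume "linf_rel f f" "linf_rel g g"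
    then have f: "ess_bounded f" and g: "ess_bounded g" by (simp_all add: linf_rel_def)
    have "AE x in lebesgue. \<bar>f x * g x\<bar> \<le> real_of_ereal (ess_norm f) * real_of_ereal (ess_norm g)"
      using ess_bounded_AE[OF f] ess_bounded_AE[OF g]
      by eventually_elim (simp add: abs_mult mult_mono)
    then show "real_of_ereal (ess_norm (\<lambda>x. f x * g x))
        \<le> real_of_ereal (ess_norm f) * real_of_ereal (ess_norm g)"
      by (intro real_ess_norm_le ess_bounded_measurable ess_bounded_mult f g)
  qed
  show "norm (a *\<^sub>R f) = \<bar>a\<bar> * norm f"
  proof (transfer fixing: a)
    fix f :: "'a \<Rightarrow> real" assume "linf_rel f f"
    then have f: "ess_bounded f" by (simp add: linf_rel_def)
    have le: "real_of_ereal (ess_norm (\<lambda>x. c * g x)) \<le> \<bar>c\<bar> * real_of_ereal (ess_norm g)"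
      if g: "ess_bounded g" for c and g :: "'a \<Rightarrow> real"
    proof (intro real_ess_norm_le ess_bounded_measurable ess_bounded_cmult g)
      show "AE x in lebesgue. \<bar>c * g x\<bar> \<le> \<bar>c\<bar> * real_of_ereal (ess_norm g)"
        using ess_bounded_AE[OF g] by eventually_elim (simp add: abs_mult mult_left_mono)
    qed
    show "real_of_ereal (ess_norm (\<lambda>x. a * f x)) = \<bar>a\<bar> * real_of_ereal (ess_norm f)"
    proof (cases "a = 0")
      case True
      then have "\<bar>a\<bar> * real_of_ereal (ess_norm f) = 0" by simp
      then show ?thesis
        using le[OF f, of a] real_ess_norm_nonneg[of "\<lambda>x. a * f x"] by linarith
    next
      case False
      have "real_of_ereal (ess_norm f) \<le> \<bar>inverse a\<bar> * real_of_ereal (ess_norm (\<lambda>x. a * f x))"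
        using le[OF ess_bounded_cmult[OF f], of "inverse a" a] False
        by (simp add: mult.assoc[symmetric])
      then have "\<bar>a\<bar> * real_of_ereal (ess_norm f) \<le> real_of_ereal (ess_norm (\<lambda>x. a * f x))"
        using False by (simp add: field_simps)
      with le[OF f, of a] show ?thesis by linarith
    qed
  qed
  show "norm (1 :: 'a linf) = 1"
  proof transfer
    have "esssup (lebesgue :: 'a measure) (\<lambda>x. 1 :: ereal) = 1"
      by (rule esssup_const) simp
    then show "real_of_ereal (ess_norm (\<lambda>_ :: 'a. 1)) = 1"
      by (simp add: ess_norm_def one_ereal_def[symmetric])
  qed
qed

end

definition L_infinity :: "'a::euclidean_space linf set"
  where "L_infinity = UNIV"


section \<open>The evolution equation\<close>

text \<open>The space \<open>E\<close> is given as a set \<open>E\<close> of elements of an ambient ordered normed algebra: all of it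
  for \<^const>\<open>C_b\<close> and \<^const>\<open>L_infinity\<close>, a closed subalgebra for \<^const>\<open>C_ub\<close>. Operators and curves
  are only ever used on \<open>E\<close>.\<close>

definition nonneg_ball :: "'e::{real_normed_algebra_1, order} set \<Rightarrow> real \<Rightarrow> 'e set"
  where "nonneg_ball E r = {v \<in> E. 0 \<le> v \<and> v \<le> of_real r}"

definition admissible_operators ::
  "'e::{real_normed_algebra_1, order} set \<Rightarrow> real \<Rightarrow> real \<Rightarrow> ('e \<Rightarrow> 'e) \<Rightarrow> ('e \<Rightarrow> 'e) \<Rightarrow> bool"
  where "admissible_operators E \<kappa> K A G \<longleftrightarrow>
    A \<in> E \<rightarrow> E \<and> G \<in> E \<rightarrow> E \<and>
    (\<forall>v\<in>E. 0 \<le> v \<longrightarrow> 0 \<le> G v \<and> 0 \<le> A v) \<and>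
    (\<forall>v\<in>E. \<forall>w\<in>E. 0 \<le> v \<longrightarrow> 0 \<le> w \<longrightarrow> norm (A v - A w) \<le> K * norm (v - w)) \<and>
    (\<forall>r>0. \<forall>v\<in>nonneg_ball E r. \<forall>w\<in>nonneg_ball E r.
       norm (G v - G w) \<le> exp (\<kappa> * r) * norm (v - w))"

text \<open>A curve on \<open>[0,T]\<close> is an element of the extensional function space, so that two curves are equal
  as soon as they agree on \<open>[0,T]\<close>. The derivative at \<open>T\<close> is one-sided.\<close>

definition classical_solution ::
  "'e::{real_normed_algebra_1, order} set \<Rightarrow> ('e \<Rightarrow> 'e) \<Rightarrow> ('e \<Rightarrow> 'e) \<Rightarrow> real \<Rightarrow> real \<Rightarrow> 'e
    \<Rightarrow> (real \<Rightarrow> 'e) \<Rightarrow> bool"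
  where "classical_solution E A G m T u0 u \<longleftrightarrow>
    u \<in> {0..T} \<rightarrow>\<^sub>E E \<and> continuous_on {0..T} u \<and> u 0 = u0 \<and>
    (\<exists>u' \<in> {0<..T} \<rightarrow> E. continuous_on {0<..T} u' \<and>
       (\<forall>t\<in>{0<..T}. (u has_vector_derivative u' t) (at t within {0..T}) \<and>
          u' t = A (u t) - m *\<^sub>R u t - u t * G (u t)))"

end

theory Submission
  imports Defs
begin

text \<open>
  The right-hand side \<open>F v = A v - m v - v G v\<close> is Lipschitz on norm-bounded sets of nonnegative
  functions, so the content of the theorem is that a local solution stays nonnegative and cannot blow up.
  Both follow from adding a multiple of the identity. If \<open>\<parallel>G v\<parallel> \<le> \<gamma>\<close> for all nonnegative \<open>v\<close> with
  \<open>\<parallel>v\<parallel> \<le> r\<close>, then with \<open>\<mu> = m + \<gamma>\<close> the map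
  \<open>g v = F v + \<mu> v = A v + (\<gamma> v - v G v)\<close> takes nonnegative values there, because
  \<open>0 \<le> G v \<le> \<gamma>\<close> pointwise; and \<open>0 \<le> \<gamma> v - v G v \<le> \<gamma> v\<close> gives
  \<open>\<parallel>g v\<parallel> \<le> \<parallel>A 0\<parallel> + (K + \<mu>) \<parallel>v\<parallel>\<close>, in which \<open>\<gamma>\<close> enters only through \<open>\<mu>\<close>. In the mild form
  \<open>u(t) = exp(-\<mu>t) u0 + \<integral> exp(-\<mu>(t-s)) g(u(s)) ds\<close> (over \<open>0 \<le> s \<le> t\<close>)
  the factor \<open>exp(-\<mu>t)\<close> absorbs \<open>\<mu>\<close>, and the right-hand side maps the set of continuous curves with
  \<open>u(t) \<ge> 0\<close> and \<open>\<parallel>u(t)\<parallel> \<le> c exp(Lt)\<close> into itself, where \<open>c = \<parallel>u0\<parallel> + 1\<close> and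
  \<open>L = \<parallel>A 0\<parallel> + K\<close> do not depend on \<open>\<mu>\<close>. So \<open>r = c exp(LT)\<close> may be fixed first and \<open>\<mu>\<close> afterwards.
  In a sup norm with exponential weight the map is a contraction, and Banach's theorem yields a
  solution on the whole of \<open>[0,T]\<close> at once (\<open>semilinear_solution_in_cone\<close>,
  \<open>solution_exists\<close>). Uniqueness is Gronwall's lemma.

  Only order, norm and product of the space enter: the argument runs in any closed subalgebra of a
  Banach algebra whose order satisfies the axioms of the class \<open>ordered_banach_algebra\<close> below.
  The nonnegative elements form a closed convex cone, which contains the integrals of curves in it;
  this replaces pointwise evaluation, which is not available in \<open>L\<^sup>\<infinity>\<close>. It remains to check
  the axioms, of which completeness of \<open>L\<^sup>\<infinity>\<close> is the only one that needs an argument, and that the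
  uniformly continuous functions are a closed subalgebra of the bounded continuous ones.
\<close>

section \<open>Ordered Banach algebras\<close>

text \<open>
  A real Banach algebra with unit and a vector space order for which products of nonnegative elements
  are nonnegative, \<open>x \<le> \<parallel>x\<parallel> 1\<close>, the norm is monotone on nonnegative elements, and the cone of
  nonnegative elements is closed. The multiplication need not be commutative.
\<close>

class ordered_banach_algebra = banach + real_normed_algebra_1 + ordered_real_vector +
  assumes mult_nonneg_nonneg_oba: "0 \<le> x \<Longrightarrow> 0 \<le> y \<Longrightarrow> 0 \<le> x * y"
    and le_norm_scaleR_one: "x \<le> norm x *\<^sub>R 1"
    and norm_mono_nonneg: "0 \<le> x \<Longrightarrow> x \<le> y \<Longrightarrow> norm x \<le> norm y"
    and closed_nonneg_cone: "closed {x. 0 \<le> x}"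

lemma zero_le_one_oba: "0 \<le> (1 :: 'a::ordered_banach_algebra)"
proof -
  have "- 1 \<le> (1 :: 'a)"
    using le_norm_scaleR_one[of "- 1 :: 'a"] by simp
  then have "0 \<le> (1 :: 'a) + 1"
    by (metis add.commute add.right_inverse add_left_mono)
  then have "0 \<le> (1/2) *\<^sub>R (1 :: 'a) + (1/2) *\<^sub>R 1"
    using scaleR_nonneg_nonneg[of "1/2" "1 + 1 :: 'a"] by (simp only: scaleR_add_right)
  then show ?thesis
    by (simp flip: scaleR_add_left)
qed

section \<open>Integral curves in a closed convex cone\<close>

text \<open>Each Riemann sum of \<open>f\<close> lies in the cone, and the integral is a limit of Riemann sums.\<close>

lemma has_integral_in_closed_convex_cone:
  fixes f :: "real \<Rightarrow> 'e::real_normed_vector"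
  assumes int: "(f has_integral y) {a..b}" and P: "closed P" "convex_cone P"
    and f: "\<And>t. t \<in> {a..b} \<Longrightarrow> f t \<in> P"
  shows "y \<in> P"
proof -
  have "\<exists>s\<in>P. dist s y < e" if "e > 0" for e
  proof -
    obtain \<gamma> where \<gamma>: "gauge \<gamma>" "\<And>\<D>. \<D> tagged_division_of {a..b} \<Longrightarrow> \<gamma> fine \<D> \<Longrightarrow>
        norm ((\<Sum>(x, k)\<in>\<D>. measure lborel k *\<^sub>R f x) - y) < e"
      using int \<open>e > 0\<close> unfolding has_integral_real by metis
    obtain \<D> where \<D>: "\<D> tagged_division_of {a..b}" "\<gamma> fine \<D>"
      using fine_division_exists_real[OF \<gamma>(1)] .
    have sum_P: "(\<Sum>p\<in>S. case p of (x, k) \<Rightarrow> measure lborel k *\<^sub>R f x) \<in> P" if "finite S" "S \<subseteq> \<D>" for S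
      using that
    proof (induction S)
      case empty
      then show ?case using P(2) by (simp add: convex_cone_iff)
    next
      case (insert p S)
      then have "f (fst p) \<in> P"
        using tagged_division_ofD(2,3)[OF \<D>(1), of "fst p" "snd p"] by (auto intro!: f)
      with insert show ?case
        using P(2) by (auto simp: case_prod_beta intro!: convex_cone_add convex_cone_scaleR)
    qed
    have "finite \<D>" using \<D>(1) by (rule tagged_division_of_finite)
    then show ?thesis
      using sum_P[of \<D>] \<gamma>(2)[OF \<D>] by (auto simp: dist_norm)
  qed
  then have "y \<in> closure P" by (simp add: closure_approachable)
  with P(1) show ?thesis by simp
qed

lemma has_integral_exp_real:
  fixes M t :: real
  assumes "0 \<le> t"
  shows "((\<lambda>s. M * exp (M * s)) has_integral exp (M * t) - 1) {0..t}"
proof -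
  have "((\<lambda>s. M * exp (M * s)) has_integral exp (M * t) - exp (M * 0)) {0..t}"
    using assms
    by (intro fundamental_theorem_of_calculus)
      (auto intro!: derivative_eq_intros simp flip: has_real_derivative_iff_has_vector_derivative)
  then show ?thesis by simp
qed

lemma norm_integral_le_exp:
  fixes f :: "real \<Rightarrow> 'e::banach"
  assumes "0 \<le> t" and f: "continuous_on {0..t} f"
    and bound: "\<And>s. s \<in> {0..t} \<Longrightarrow> norm (f s) \<le> C * (M * exp (M * s))"
  shows "norm (integral {0..t} f) \<le> C * (exp (M * t) - 1)"
proof -
  have I: "((\<lambda>s. C * (M * exp (M * s))) has_integral C * (exp (M * t) - 1)) {0..t}"
    by (intro has_integral_mult_right has_integral_exp_real assms)
  have "norm (integral {0..t} f) \<le> integral {0..t} (\<lambda>s. C * (M * exp (M * s)))"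
    by (intro integral_norm_bound_integral bound integrable_continuous_real f has_integral_integrable[OF I])
  then show ?thesis unfolding integral_unique[OF I] .
qed

text \<open>
  Existence on all of \<open>[0,T]\<close> for \<open>u' = g u - \<mu> u\<close> in a closed convex cone. The growth bound is
  imposed on each ball of radius \<open>s\<close> between \<open>c\<close> and \<open>c exp(LT)\<close>, which is what keeps
  \<open>\<parallel>u(t)\<parallel> \<le> c exp(Lt)\<close> invariant; \<open>g\<close> has to be controlled in the part of the cone of norm at
  most \<open>c exp(LT)\<close> only.
\<close>

theorem semilinear_solution_in_cone:
  fixes P :: "'e::banach set" and g :: "'e \<Rightarrow> 'e" and c L N T \<mu> :: real
  assumes P: "closed P" "convex_cone P" and u0: "u0 \<in> P" "norm u0 \<le> c"
    and nonneg: "0 < c" "0 \<le> L" "0 \<le> \<mu>" "0 < N" "0 \<le> T"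
    and g_P: "\<And>v. v \<in> P \<Longrightarrow> norm v \<le> c * exp (L * T) \<Longrightarrow> g v \<in> P"
    and g_bound: "\<And>v s. v \<in> P \<Longrightarrow> norm v \<le> s \<Longrightarrow> c \<le> s \<Longrightarrow> s \<le> c * exp (L * T)
        \<Longrightarrow> norm (g v) \<le> (L + \<mu>) * s"
    and g_lip: "\<And>v w. v \<in> P \<Longrightarrow> w \<in> P \<Longrightarrow> norm v \<le> c * exp (L * T) \<Longrightarrow> norm w \<le> c * exp (L * T)
        \<Longrightarrow> norm (g v - g w) \<le> N * norm (v - w)"
  obtains u where "u 0 = u0" "\<And>t. t \<in> {0..T} \<Longrightarrow> u t \<in> P"
    "\<And>t. t \<in> {0..T} \<Longrightarrow> (u has_vector_derivative g (u t) - \<mu> *\<^sub>R u t) (at t within {0..T})"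
proof -
  \<comment> \<open>The unknown is \<open>z(t) = exp((\<mu> - M)t) u(t)\<close>: the sup norm of \<open>z\<close> is an exponentially weighted
    norm of \<open>u\<close>, for which the mild form is a contraction with constant \<open>N / M = 1/2\<close>.\<close>
  define M where "M = 2 * N"
  define B where "B = {v \<in> P. norm v \<le> c * exp (L * T)}"
  have g_cont: "continuous_on B g"
    using nonneg by (intro lipschitz_on_continuous_on[of N] lipschitz_onI) (auto simp: B_def dist_norm g_lip)
  \<comment> \<open>Curves on \<open>[0,T]\<close> are extended by constants to bounded continuous curves on the whole line.\<close>
  define cl where "cl t = max 0 (min T t)" for t :: real
  have cl: "cl t \<in> {0..T}" for t
    using nonneg by (auto simp: cl_def)
  have cl_id: "cl t = t" if "t \<in> {0..T}" for t
    using that by (auto simp: cl_def)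
  have cl_cont: "continuous_on S cl" for S
    unfolding cl_def by (intro continuous_intros)
  \<comment> \<open>In terms of \<open>z\<close>, the bound \<open>norm (u t) \<le> c * exp (L * t)\<close> reads \<open>norm (z t) \<le> R t\<close>.\<close>
  define R where "R t = c * exp ((L + \<mu> - M) * cl t)" for t
  define S where "S = {z :: real \<Rightarrow>\<^sub>C 'e. \<forall>t. z t \<in> P \<inter> cball 0 (R t)}"
  \<comment> \<open>\<open>v z\<close> is the curve \<open>u\<close> that belongs to \<open>z\<close>.\<close>
  define v where "v z s = exp ((M - \<mu>) * s) *\<^sub>R apply_bcontfun z s" for z :: "real \<Rightarrow>\<^sub>C 'e" and s
  define h where "h z s = exp (\<mu> * s) *\<^sub>R g (v z s)" for z s
  define \<Psi> where "\<Psi> z t = exp (- M * t) *\<^sub>R (u0 + integral {0..t} (h z))" for z t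
  define \<Phi> where "\<Phi> z = Bcontfun (\<lambda>t. \<Psi> z (cl t))" for z

  have v_bound: "norm (v z t) \<le> c * exp (L * t)" and v_P: "v z t \<in> P" and v_B: "v z t \<in> B"
    if "z \<in> S" "t \<in> {0..T}" for z t
  proof -
    have "norm (apply_bcontfun z t) \<le> c * exp ((L + \<mu> - M) * t)" and P_z: "apply_bcontfun z t \<in> P"
      using that(1)[unfolded S_def, simplified, rule_format, of t] cl_id[OF that(2)] by (simp_all add: R_def)
    then have "norm (v z t) \<le> exp ((M - \<mu>) * t) * (c * exp ((L + \<mu> - M) * t))"
      by (simp add: v_def)
    also have "\<dots> = c * exp (L * t)"
      by (simp add: mult_exp_exp algebra_simps)
    finally show 1: "norm (v z t) \<le> c * exp (L * t)" .
    show 2: "v z t \<in> P"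
      unfolding v_def using P(2) P_z by (intro convex_cone_scaleR) auto
    have "c * exp (L * t) \<le> c * exp (L * T)"
      using that nonneg by (auto intro!: mult_left_mono)
    with 1 2 show "v z t \<in> B" by (simp add: B_def)
  qed
  have h_cont: "continuous_on {0..T} (h z)" if "z \<in> S" for z
    unfolding h_def v_def
    by (intro continuous_intros continuous_on_compose2[OF g_cont])
      (use v_B[OF that] in \<open>auto simp: v_def\<close>)
  have h_int: "h z integrable_on {0..t}" if "z \<in> S" "t \<in> {0..T}" for z t
    using h_cont[OF that(1)] that(2)
    by (intro integrable_continuous_real) (auto elim: continuous_on_subset)
  have h_P: "h z t \<in> P" if "z \<in> S" "t \<in> {0..T}" for z t
    unfolding h_def using v_B[OF that] P(2) by (intro convex_cone_scaleR g_P) (auto simp: B_def)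
  have \<Psi>_cont: "continuous_on {0..T} (\<Psi> z)" if "z \<in> S" for z
    unfolding \<Psi>_def using h_int[OF that, of T] nonneg
    by (intro continuous_intros indefinite_integral_continuous_1) auto
  have \<Phi>_apply: "apply_bcontfun (\<Phi> z) t = \<Psi> z (cl t)" if "z \<in> S" for z t
  proof -
    have "compact (\<Psi> z ` {0..T})"
      using \<Psi>_cont[OF that] by (intro compact_continuous_image) auto
    then have "bounded (range (\<lambda>t. \<Psi> z (cl t)))"
      using cl by (intro bounded_subset[OF compact_imp_bounded]) auto
    moreover have "continuous_on UNIV (\<lambda>t. \<Psi> z (cl t))"
      using cl by (intro continuous_on_compose2[OF \<Psi>_cont[OF that] cl_cont]) auto
    ultimately show ?thesis
      unfolding \<Phi>_def by (subst Bcontfun_inverse) (auto simp: bcontfun_def)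
  qed
  have \<Psi>_P: "\<Psi> z t \<in> P" if "z \<in> S" "t \<in> {0..T}" for z t
  proof -
    have "integral {0..t} (h z) \<in> P"
      using that by (intro has_integral_in_closed_convex_cone[OF integrable_integral[OF h_int[OF that]] P])
        (auto intro: h_P)
    then show ?thesis
      unfolding \<Psi>_def using P(2) u0(1) by (intro convex_cone_scaleR convex_cone_add) auto
  qed
  have \<Psi>_bound: "norm (\<Psi> z t) \<le> c * exp ((L + \<mu> - M) * t)" if "z \<in> S" "t \<in> {0..T}" for z t
  proof -
    have h_bound: "norm (h z s) \<le> c * ((L + \<mu>) * exp ((L + \<mu>) * s))" if s: "s \<in> {0..t}" for s
    proof -
      have s': "s \<in> {0..T}" using s \<open>t \<in> {0..T}\<close> by auto
      have "norm (g (v z s)) \<le> (L + \<mu>) * (c * exp (L * s))"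
        using nonneg s' by (intro g_bound v_P v_bound \<open>z \<in> S\<close>) (auto intro!: mult_left_mono)
      then have "norm (h z s) \<le> exp (\<mu> * s) * ((L + \<mu>) * (c * exp (L * s)))"
        by (simp add: h_def)
      also have "\<dots> = c * ((L + \<mu>) * exp ((L + \<mu>) * s))"
        by (simp add: algebra_simps exp_add)
      finally show ?thesis .
    qed
    have "norm (integral {0..t} (h z)) \<le> c * (exp ((L + \<mu>) * t) - 1)"
      using that by (intro norm_integral_le_exp h_bound continuous_on_subset[OF h_cont]) auto
    then have "norm (u0 + integral {0..t} (h z)) \<le> c * exp ((L + \<mu>) * t)"
      using u0(2) norm_triangle_ineq[of u0 "integral {0..t} (h z)"] by (simp add: algebra_simps)
    then have "norm (\<Psi> z t) \<le> exp (- M * t) * (c * exp ((L + \<mu>) * t))"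
      by (simp add: \<Psi>_def)
    also have "\<dots> = c * exp ((L + \<mu> - M) * t)"
      by (simp add: mult_exp_exp algebra_simps)
    finally show ?thesis .
  qed
  have \<Psi>_lip: "norm (\<Psi> z t - \<Psi> y t) \<le> 1/2 * dist z y" if "z \<in> S" "y \<in> S" "t \<in> {0..T}" for z y t
  proof -
    have h_diff: "norm (h z s - h y s) \<le> dist z y / 2 * (M * exp (M * s))" if s: "s \<in> {0..t}" for s
    proof -
      have s': "s \<in> {0..T}" using s \<open>t \<in> {0..T}\<close> by auto
      have "norm (h z s - h y s) = exp (\<mu> * s) * norm (g (v z s) - g (v y s))"
        by (simp add: h_def flip: scaleR_diff_right)
      also have "\<dots> \<le> exp (\<mu> * s) * (N * norm (v z s - v y s))"
        using v_B[OF \<open>z \<in> S\<close> s'] v_B[OF \<open>y \<in> S\<close> s']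
        by (intro mult_left_mono g_lip) (auto simp: B_def)
      also have "\<dots> = N * exp (M * s) * dist (apply_bcontfun z s) (apply_bcontfun y s)"
        by (simp add: v_def dist_norm mult_exp_exp algebra_simps flip: scaleR_diff_right)
      also have "\<dots> \<le> N * exp (M * s) * dist z y"
        using nonneg by (intro mult_left_mono dist_bounded) auto
      finally show ?thesis by (simp add: M_def mult_ac)
    qed
    have "\<Psi> z t - \<Psi> y t = exp (- M * t) *\<^sub>R integral {0..t} (\<lambda>s. h z s - h y s)"
      using h_int[OF that(1,3)] h_int[OF that(2,3)]
      by (simp add: \<Psi>_def integral_diff flip: scaleR_diff_right)
    then have "norm (\<Psi> z t - \<Psi> y t) = exp (- M * t) * norm (integral {0..t} (\<lambda>s. h z s - h y s))"
      by simp
    also have "\<dots> \<le> exp (- M * t) * (dist z y / 2 * (exp (M * t) - 1))"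
      using that
      by (intro mult_left_mono norm_integral_le_exp h_diff continuous_on_diff continuous_on_subset[OF h_cont]) auto
    also have "\<dots> = dist z y / 2 * (1 - exp (- M * t))"
      by (simp add: algebra_simps mult_exp_exp)
    also have "\<dots> \<le> dist z y / 2 * 1"
      by (intro mult_left_mono) auto
    finally show ?thesis by simp
  qed
  have "S = PiC UNIV (\<lambda>t. P \<inter> cball 0 (R t))"
    by (auto simp: S_def mem_PiC_iff Pi_def)
  then have "closed S"
    using P(1) by (auto intro!: closed_PiC)
  have "\<exists>!z\<in>S. \<Phi> z = z"
  proof (rule Banach_fix[where c = "1/2"])
    show "complete S" using \<open>closed S\<close> by (simp add: complete_eq_closed)
    have "const_bcontfun 0 \<in> S"
      using P(2) nonneg by (auto simp: S_def R_def convex_cone_iff)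
    then show "S \<noteq> {}" by blast
    show "\<Phi> ` S \<subseteq> S"
      using \<Psi>_P[OF _ cl] \<Psi>_bound[OF _ cl] by (force simp: S_def R_def \<Phi>_apply)
    show "dist (\<Phi> z) (\<Phi> y) \<le> 1/2 * dist z y" if "z \<in> S" "y \<in> S" for z y
      using that \<Psi>_lip[OF that cl]
      by (intro dist_bound) (simp add: \<Phi>_apply dist_norm)
  qed auto
  then obtain z where z: "z \<in> S" "\<Phi> z = z" by blast
  have z_eq: "apply_bcontfun z t = exp (- M * t) *\<^sub>R (u0 + integral {0..t} (h z))" if "t \<in> {0..T}" for t
    using \<Phi>_apply[OF z(1), of t] z(2) cl_id[OF that] by (simp add: \<Psi>_def)
  define u where "u t = exp (- \<mu> * t) *\<^sub>R (u0 + integral {0..t} (h z))" for t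
  have u_v: "u t = v z t" if "t \<in> {0..T}" for t
    by (simp add: u_def v_def z_eq[OF that] mult_exp_exp algebra_simps)
  show ?thesis
  proof
    show "u 0 = u0" by (simp add: u_def)
    show "u t \<in> P" if "t \<in> {0..T}" for t
      using v_P[OF z(1) that] u_v[OF that] by simp
    show "(u has_vector_derivative g (u t) - \<mu> *\<^sub>R u t) (at t within {0..T})" if "t \<in> {0..T}" for t
    proof -
      have "((\<lambda>t. u0 + integral {0..t} (h z)) has_vector_derivative h z t) (at t within {0..T})"
        using integral_has_vector_derivative[OF h_cont[OF z(1)] that]
        by (auto intro!: derivative_eq_intros)
      moreover have "((\<lambda>t. exp (- \<mu> * t)) has_real_derivative - \<mu> * exp (- \<mu> * t)) (at t within {0..T})"
        by (auto intro!: derivative_eq_intros)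
      ultimately have "(u has_vector_derivative exp (- \<mu> * t) *\<^sub>R h z t
          + (- \<mu> * exp (- \<mu> * t)) *\<^sub>R (u0 + integral {0..t} (h z))) (at t within {0..T})"
        unfolding u_def by (intro has_vector_derivative_scaleR)
      also have "exp (- \<mu> * t) *\<^sub>R h z t + (- \<mu> * exp (- \<mu> * t)) *\<^sub>R (u0 + integral {0..t} (h z))
          = g (u t) - \<mu> *\<^sub>R u t"
        by (simp add: h_def u_v[OF that, symmetric] mult_exp_exp) (simp add: u_def)
      finally show ?thesis .
    qed
  qed
qed

text \<open>
  Gronwall's lemma for the zero bound. At a maximum point \<open>t0\<close> of \<open>exp(-2Ns) d(s)\<close> the
  hypothesis bounds the maximum by half of itself.
\<close>

lemma Gronwall_zero:
  fixes d :: "real \<Rightarrow> real"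
  assumes d: "continuous_on {0..T} d" "\<And>t. t \<in> {0..T} \<Longrightarrow> 0 \<le> d t" and "0 < N"
    and le: "\<And>t. t \<in> {0..T} \<Longrightarrow> d t \<le> N * integral {0..t} d"
    and t: "t \<in> {0..T}"
  shows "d t = 0"
proof -
  define M where "M = 2 * N"
  have "continuous_on {0..T} (\<lambda>s. exp (- M * s) * d s)"
    by (intro continuous_intros d)
  from continuous_attains_sup[OF _ _ this]
  obtain t0 where t0: "t0 \<in> {0..T}" "\<And>s. s \<in> {0..T} \<Longrightarrow> exp (- M * s) * d s \<le> exp (- M * t0) * d t0"
    using t by auto
  define D where "D = exp (- M * t0) * d t0"
  have dD: "d s \<le> D * exp (M * s)" if "s \<in> {0..T}" for s
    using t0(2)[OF that] by (simp add: D_def exp_minus field_simps)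
  have "norm (integral {0..t0} d) \<le> D / M * (exp (M * t0) - 1)"
    using t0 d dD \<open>0 < N\<close>
    by (intro norm_integral_le_exp) (auto intro: continuous_on_subset simp: M_def)
  then have "N * integral {0..t0} d \<le> N * (D / M * (exp (M * t0) - 1))"
    using \<open>0 < N\<close> by (intro mult_left_mono) auto
  with le[OF t0(1)] have "d t0 \<le> D / 2 * (exp (M * t0) - 1)"
    using \<open>0 < N\<close> by (simp add: M_def)
  then have "D \<le> exp (- M * t0) * (D / 2 * (exp (M * t0) - 1))"
    unfolding D_def by (intro mult_left_mono) auto
  also have "\<dots> = D / 2 - D / 2 * exp (- M * t0)"
    by (simp add: algebra_simps mult_exp_exp)
  also have "\<dots> \<le> D / 2"
    using d(2)[OF t0(1)] by (simp add: D_def)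
  finally have "D \<le> 0" by simp
  then have "d t \<le> 0"
    using dD[OF t] by (meson exp_ge_zero mult_nonpos_nonneg order_trans)
  with d(2)[OF t] show ?thesis by simp
qed

section \<open>The evolution equation in a closed subalgebra\<close>

lemma in_nonneg_ballI:
  fixes v :: "'e::ordered_banach_algebra"
  assumes "v \<in> E" "0 \<le> v" "norm v \<le> r"
  shows "v \<in> nonneg_ball E r"
proof -
  have "v \<le> norm v *\<^sub>R 1" by (rule le_norm_scaleR_one)
  also have "\<dots> \<le> r *\<^sub>R 1"
    using assms(3) by (intro scaleR_right_mono zero_le_one_oba)
  finally show ?thesis
    using assms by (simp add: nonneg_ball_def of_real_def)
qed

text \<open>The data of the equation, for a closed subalgebra \<open>E\<close> that need not contain the unit.\<close>

locale positive_evolution =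
  fixes E :: "'e::ordered_banach_algebra set" and A G :: "'e \<Rightarrow> 'e" and m \<kappa> K :: real
  assumes closed_E: "closed E" and subspace_E: "subspace E"
    and mult_E: "\<And>v w. v \<in> E \<Longrightarrow> w \<in> E \<Longrightarrow> v * w \<in> E"
    and admissible: "admissible_operators E \<kappa> K A G"
    and m_pos: "0 < m" and K_pos: "0 < K"
begin

text \<open>The nonnegative elements of \<open>E\<close>.\<close>

definition cone :: "'e set"
  where "cone = {v \<in> E. 0 \<le> v}"

text \<open>The right-hand side of the equation.\<close>

definition rhs :: "'e \<Rightarrow> 'e"
  where "rhs v = A v - m *\<^sub>R v - v * G v"

text \<open>A bound for \<open>\<parallel>G v\<parallel>\<close> over nonnegative \<open>v\<close> with \<open>\<parallel>v\<parallel> \<le> r\<close>, for \<open>r > 0\<close>.\<close>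

definition G_bound :: "real \<Rightarrow> real"
  where "G_bound r = norm (G 0) + exp (\<kappa> * r) * r"

text \<open>A Lipschitz constant of \<open>rhs\<close> on the nonnegative \<open>v\<close> with \<open>\<parallel>v\<parallel> \<le> r\<close>, for \<open>r > 0\<close>.\<close>

definition rhs_lip :: "real \<Rightarrow> real"
  where "rhs_lip r = K + m + G_bound r + r * exp (\<kappa> * r)"

lemma zero_cone: "0 \<in> cone"
  using subspace_E by (simp add: cone_def subspace_0)

lemma closed_cone: "closed cone"
proof -
  have "cone = E \<inter> {v. 0 \<le> v}" by (auto simp: cone_def)
  then show ?thesis using closed_E closed_nonneg_cone by auto
qed

lemma convex_cone_cone: "convex_cone cone"
  unfolding convex_cone_iff cone_def
  using subspace_E by (auto simp: subspace_0 subspace_add subspace_scale scaleR_nonneg_nonneg)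

lemma A_cone: "v \<in> cone \<Longrightarrow> A v \<in> cone" and G_cone: "v \<in> cone \<Longrightarrow> G v \<in> cone"
  using admissible by (auto simp: cone_def admissible_operators_def)

lemma A_lip: "v \<in> cone \<Longrightarrow> w \<in> cone \<Longrightarrow> norm (A v - A w) \<le> K * norm (v - w)"
  using admissible by (auto simp: cone_def admissible_operators_def)

lemma A_norm_le:
  assumes "v \<in> cone"
  shows "norm (A v) \<le> norm (A 0) + K * norm v"
  using A_lip[OF assms zero_cone] norm_triangle_sub[of "A v" "A 0"] by simp

lemma G_lip:
  assumes "0 < r" "v \<in> cone" "w \<in> cone" "norm v \<le> r" "norm w \<le> r"
  shows "norm (G v - G w) \<le> exp (\<kappa> * r) * norm (v - w)"
proof -
  have "v \<in> nonneg_ball E r" "w \<in> nonneg_ball E r"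
    using assms by (auto simp: cone_def intro: in_nonneg_ballI)
  then show ?thesis
    using admissible assms(1) by (simp add: admissible_operators_def)
qed

lemma norm_G_le:
  assumes "0 < r" "v \<in> cone" "norm v \<le> r"
  shows "norm (G v) \<le> G_bound r"
proof -
  have "norm (G v) \<le> norm (G 0) + norm (G v - G 0)"
    by (rule norm_triangle_sub)
  also have "norm (G v - G 0) \<le> exp (\<kappa> * r) * norm (v - 0)"
    using assms zero_cone by (intro G_lip) auto
  also have "\<dots> \<le> exp (\<kappa> * r) * r"
    using assms by simp
  finally show ?thesis by (simp add: G_bound_def)
qed

lemma G_bound_nonneg: "0 < r \<Longrightarrow> 0 \<le> G_bound r"
  by (simp add: G_bound_def)

lemma rhs_lip_pos: "0 < r \<Longrightarrow> 0 < rhs_lip r"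
  using m_pos K_pos G_bound_nonneg[of r] by (simp add: rhs_lip_def add_pos_nonneg)

lemma rhs_in_E: "v \<in> cone \<Longrightarrow> rhs v \<in> E"
  using A_cone[of v] G_cone[of v]
  by (auto simp: rhs_def cone_def intro!: subspace_diff[OF subspace_E] subspace_scale[OF subspace_E] mult_E)

lemma norm_rhs_diff_le:
  assumes r: "0 < r" and v: "v \<in> cone" "norm v \<le> r" and w: "w \<in> cone" "norm w \<le> r"
  shows "norm (rhs v - rhs w) \<le> rhs_lip r * norm (v - w)"
proof -
  have eq: "rhs v - rhs w = (A v - A w) - m *\<^sub>R (v - w) - ((v - w) * G v + w * (G v - G w))"
    by (simp add: rhs_def algebra_simps)
  have "norm (rhs v - rhs w)
      \<le> norm (A v - A w) + norm (m *\<^sub>R (v - w)) + (norm ((v - w) * G v) + norm (w * (G v - G w)))"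
    unfolding eq by (intro order_trans[OF norm_triangle_ineq4] add_mono norm_triangle_ineq norm_triangle_ineq4)
  also have "\<dots> \<le> K * norm (v - w) + m * norm (v - w)
      + (norm (v - w) * G_bound r + r * (exp (\<kappa> * r) * norm (v - w)))"
  proof (intro add_mono)
    show "norm (A v - A w) \<le> K * norm (v - w)" using v w by (intro A_lip)
    show "norm (m *\<^sub>R (v - w)) \<le> m * norm (v - w)" using m_pos by simp
    show "norm ((v - w) * G v) \<le> norm (v - w) * G_bound r"
      by (intro order_trans[OF norm_mult_ineq] mult_left_mono norm_G_le r v) auto
    show "norm (w * (G v - G w)) \<le> r * (exp (\<kappa> * r) * norm (v - w))"
      using r by (intro order_trans[OF norm_mult_ineq] mult_mono G_lip v w) auto
  qed
  also have "\<dots> = rhs_lip r * norm (v - w)"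
    by (simp add: rhs_lip_def algebra_simps)
  finally show ?thesis .
qed

text \<open>
  After the shift by \<open>G_bound r\<close> the nonlinear term is nonnegative and, by monotonicity of the norm,
  no larger than the shift itself. The first gives positivity, the second excludes blow-up.
\<close>

lemma damping_bounds:
  assumes "0 < r" "v \<in> cone" "norm v \<le> r"
  shows "0 \<le> G_bound r *\<^sub>R v - v * G v" "G_bound r *\<^sub>R v - v * G v \<le> G_bound r *\<^sub>R v"
proof -
  have "G v \<le> norm (G v) *\<^sub>R 1"
    by (rule le_norm_scaleR_one)
  also have "\<dots> \<le> G_bound r *\<^sub>R 1"
    using norm_G_le[OF assms] by (intro scaleR_right_mono zero_le_one_oba)
  finally have "0 \<le> v * (G_bound r *\<^sub>R 1 - G v)"
    using assms by (intro mult_nonneg_nonneg_oba) (auto simp: cone_def)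
  then show "0 \<le> G_bound r *\<^sub>R v - v * G v"
    by (simp add: right_diff_distrib)
  have "0 \<le> v * G v"
    using assms(2) G_cone[OF assms(2)] by (intro mult_nonneg_nonneg_oba) (auto simp: cone_def)
  then show "G_bound r *\<^sub>R v - v * G v \<le> G_bound r *\<^sub>R v"
    by simp
qed

lemma continuous_curve_bounded:
  fixes u :: "real \<Rightarrow> 'e"
  assumes "continuous_on {0..T} u"
  shows "\<exists>r>0. \<forall>t\<in>{0..T}. norm (u t) \<le> r"
proof -
  have "bounded (u ` {0..T})"
    using assms by (intro compact_imp_bounded compact_continuous_image) auto
  then show ?thesis
    by (simp add: bounded_pos)
qed

lemma continuous_on_rhs:
  fixes u :: "real \<Rightarrow> 'e"
  assumes u: "continuous_on {0..T} u" "\<And>t. t \<in> {0..T} \<Longrightarrow> u t \<in> cone"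
  shows "continuous_on {0..T} (\<lambda>t. rhs (u t))"
proof -
  obtain r where r: "0 < r" "\<And>t. t \<in> {0..T} \<Longrightarrow> norm (u t) \<le> r"
    using continuous_curve_bounded[OF u(1)] by blast
  have "continuous_on {v \<in> cone. norm v \<le> r} rhs"
    using norm_rhs_diff_le[OF r(1)] rhs_lip_pos[OF r(1)]
    by (intro lipschitz_on_continuous_on[of "rhs_lip r"] lipschitz_onI) (auto simp: dist_norm)
  then show ?thesis
    by (rule continuous_on_compose2[OF _ u(1)]) (use u r in auto)
qed

lemma solution_exists:
  assumes "0 < T" and u0: "u0 \<in> cone"
  obtains u where "u 0 = u0" "\<And>t. t \<in> {0..T} \<Longrightarrow> u t \<in> cone"
    "\<And>t. t \<in> {0..T} \<Longrightarrow> (u has_vector_derivative rhs (u t)) (at t within {0..T})"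
proof -
  \<comment> \<open>\<open>c \<ge> 1\<close> allows the constant \<open>norm (A 0)\<close> to be bounded by \<open>norm (A 0) * s\<close> for \<open>s \<ge> c\<close>.\<close>
  define c L where "c = norm u0 + 1" and "L = norm (A 0) + K"
  define r where "r = c * exp (L * T)"
  define \<mu> where "\<mu> = m + G_bound r"
  define g where "g v = rhs v + \<mu> *\<^sub>R v" for v
  have c: "1 \<le> c" "norm u0 \<le> c" by (simp_all add: c_def)
  have r: "0 < r" using c by (simp add: r_def)
  have \<mu>: "0 \<le> \<mu>" using m_pos G_bound_nonneg[OF r] by (simp add: \<mu>_def)
  have g_eq: "g v = A v + (G_bound r *\<^sub>R v - v * G v)" for v
    by (simp add: g_def rhs_def \<mu>_def algebra_simps)
  obtain u where "u 0 = u0" "\<And>t. t \<in> {0..T} \<Longrightarrow> u t \<in> cone"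
    "\<And>t. t \<in> {0..T} \<Longrightarrow> (u has_vector_derivative g (u t) - \<mu> *\<^sub>R u t) (at t within {0..T})"
  proof (rule semilinear_solution_in_cone[OF closed_cone convex_cone_cone u0,
        where c = c and L = L and T = T and g = g and \<mu> = \<mu> and N = "rhs_lip r + \<mu>"], goal_cases)
    case (7 v)
    then have v: "v \<in> cone" "norm v \<le> r" by (simp_all add: r_def)
    have "g v \<in> E"
      using rhs_in_E[OF v(1)] v(1) unfolding g_def
      by (intro subspace_add[OF subspace_E] subspace_scale[OF subspace_E]) (auto simp: cone_def)
    moreover have "0 \<le> g v"
      unfolding g_eq using A_cone[OF v(1)] damping_bounds(1)[OF r v] by (simp add: cone_def)
    ultimately show ?case by (simp add: cone_def)
  next
    case (8 v s)
    then have v: "v \<in> cone" "norm v \<le> r" by (simp_all add: r_def)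
    have "norm (G_bound r *\<^sub>R v - v * G v) \<le> norm (G_bound r *\<^sub>R v)"
      by (rule norm_mono_nonneg[OF damping_bounds[OF r v]])
    also have "\<dots> \<le> \<mu> * norm v"
      using m_pos G_bound_nonneg[OF r] by (simp add: \<mu>_def mult_right_mono)
    finally have "norm (g v) \<le> norm (A 0) + K * norm v + \<mu> * norm v"
      unfolding g_eq using A_norm_le[OF v(1)] by (intro order_trans[OF norm_triangle_ineq] add_mono)
    also have "\<dots> \<le> norm (A 0) * s + K * s + \<mu> * s"
      using 8 c K_pos \<mu> mult_left_mono[of 1 s "norm (A 0)"] by (intro add_mono mult_left_mono) auto
    finally show ?case by (simp add: L_def algebra_simps)
  next
    case (9 v w)
    then have v: "v \<in> cone" "norm v \<le> r" and w: "w \<in> cone" "norm w \<le> r"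
      by (simp_all add: r_def)
    have "g v - g w = (rhs v - rhs w) + \<mu> *\<^sub>R (v - w)"
      by (simp add: g_def algebra_simps)
    then have "norm (g v - g w) \<le> norm (rhs v - rhs w) + norm (\<mu> *\<^sub>R (v - w))"
      by (simp only: norm_triangle_ineq)
    also have "\<dots> \<le> rhs_lip r * norm (v - w) + \<mu> * norm (v - w)"
      using norm_rhs_diff_le[OF r v w] \<mu> by simp
    finally show ?case by (simp add: algebra_simps)
  qed (use c K_pos \<mu> rhs_lip_pos[OF r] assms in \<open>auto simp: L_def\<close>)
  then show ?thesis
    using that by (simp add: g_def)
qed

text \<open>
  No differentiability at \<open>0\<close> is needed here: the fundamental theorem of calculus asks for
  derivatives in the open interval and continuity on the closed one.
\<close>

lemma classical_solution_integral:
  assumes u: "classical_solution E A G m T u0 u" "\<And>t. t \<in> {0..T} \<Longrightarrow> 0 \<le> u t"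
    and t: "t \<in> {0..T}"
  shows "((\<lambda>s. rhs (u s)) has_integral u t - u0) {0..t}"
proof -
  have cont: "continuous_on {0..T} u" and u_0: "u 0 = u0"
    and der: "\<And>s. s \<in> {0<..T} \<Longrightarrow> (u has_vector_derivative rhs (u s)) (at s within {0..T})"
    using u(1) unfolding classical_solution_def rhs_def by metis+
  have "(u has_vector_derivative rhs (u s)) (at s)" if "s \<in> {0<..<t}" for s
  proof -
    have "at s within {0..T} = at s"
      using that t by (intro at_within_interior) auto
    then show ?thesis using der[of s] that t by auto
  qed
  then show ?thesis
    unfolding u_0[symmetric] using t
    by (intro fundamental_theorem_of_calculus_interior continuous_on_subset[OF cont]) auto
qed

lemma classical_solution_unique:
  assumes u: "classical_solution E A G m T u0 u" "\<And>t. t \<in> {0..T} \<Longrightarrow> 0 \<le> u t"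
    and v: "classical_solution E A G m T u0 v" "\<And>t. t \<in> {0..T} \<Longrightarrow> 0 \<le> v t"
  shows "u = v"
proof -
  have cont: "continuous_on {0..T} u" "continuous_on {0..T} v"
    and ext: "u \<in> {0..T} \<rightarrow>\<^sub>E E" "v \<in> {0..T} \<rightarrow>\<^sub>E E"
    using u(1) v(1) by (auto simp: classical_solution_def)
  have cone: "u t \<in> cone" "v t \<in> cone" if "t \<in> {0..T}" for t
    using ext that u(2) v(2) by (auto simp: cone_def)
  obtain r1 where r1: "0 < r1" "\<And>t. t \<in> {0..T} \<Longrightarrow> norm (u t) \<le> r1"
    using continuous_curve_bounded[OF cont(1)] by blast
  obtain r2 where r2: "0 < r2" "\<And>t. t \<in> {0..T} \<Longrightarrow> norm (v t) \<le> r2"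
    using continuous_curve_bounded[OF cont(2)] by blast
  define r where "r = max r1 r2"
  have r: "0 < r" "\<And>t. t \<in> {0..T} \<Longrightarrow> norm (u t) \<le> r" "\<And>t. t \<in> {0..T} \<Longrightarrow> norm (v t) \<le> r"
    using r1 r2 by (auto simp: r_def le_max_iff_disj)
  have "norm (u t - v t) \<le> rhs_lip r * integral {0..t} (\<lambda>s. norm (u s - v s))" if t: "t \<in> {0..T}" for t
  proof -
    have I: "((\<lambda>s. rhs (u s) - rhs (v s)) has_integral u t - v t) {0..t}"
      using has_integral_diff[OF classical_solution_integral[OF u t] classical_solution_integral[OF v t]]
      by simp
    have J: "(\<lambda>s. norm (u s - v s)) integrable_on {0..t}"
      using t by (intro integrable_continuous_real continuous_intros continuous_on_subset[OF cont(1)]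
        continuous_on_subset[OF cont(2)]) auto
    have "norm (integral {0..t} (\<lambda>s. rhs (u s) - rhs (v s)))
        \<le> integral {0..t} (\<lambda>s. rhs_lip r * norm (u s - v s))"
      using t by (intro integral_norm_bound_integral has_integral_integrable[OF I] integrable_on_mult_right J
        norm_rhs_diff_le r cone) auto
    then show ?thesis
      by (simp add: integral_unique[OF I])
  qed
  then have "norm (u t - v t) = 0" if "t \<in> {0..T}" for t
    using that cont rhs_lip_pos[OF r(1)]
    by (intro Gronwall_zero[of T "\<lambda>t. norm (u t - v t)" "rhs_lip r"] continuous_intros) auto
  then show ?thesis
    by (intro PiE_ext[OF ext]) auto
qed

theorem ex1_nonneg_classical_solution:
  assumes "0 < T" "u0 \<in> E" "0 \<le> u0"
  shows "\<exists>!u. classical_solution E A G m T u0 u \<and> (\<forall>t\<in>{0..T}. 0 \<le> u t)"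
proof (rule ex_ex1I)
  have u0_cone: "u0 \<in> cone" using assms by (simp add: cone_def)
  obtain u where u: "u 0 = u0" "\<And>t. t \<in> {0..T} \<Longrightarrow> u t \<in> cone"
    "\<And>t. t \<in> {0..T} \<Longrightarrow> (u has_vector_derivative rhs (u t)) (at t within {0..T})"
    using solution_exists[OF assms(1) u0_cone] by blast
  have u_cont: "continuous_on {0..T} u"
    unfolding continuous_on_eq_continuous_within
    using u(3) has_vector_derivative_continuous by blast
  define w where "w = restrict u {0..T}"
  have w: "w t = u t" if "t \<in> {0..T}" for t
    using that by (simp add: w_def)
  have w_der: "(w has_vector_derivative rhs (w t)) (at t within {0..T})" if "t \<in> {0..T}" for t
    using has_vector_derivative_transform[OF that, of w u] u(3)[OF that] w that by auto
  have "classical_solution E A G m T u0 w"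
    unfolding classical_solution_def
  proof (intro conjI bexI[of _ "\<lambda>t. rhs (w t)"] ballI)
    show "w \<in> {0..T} \<rightarrow>\<^sub>E E" using u(2) by (auto simp: w_def cone_def)
    show "continuous_on {0..T} w" by (rule continuous_on_eq[OF u_cont]) (simp add: w)
    show "w 0 = u0" using u(1) w[of 0] assms by simp
    show "continuous_on {0<..T} (\<lambda>t. rhs (w t))"
      by (rule continuous_on_eq[OF continuous_on_subset[OF continuous_on_rhs[OF u_cont u(2)]]]) (auto simp: w)
    show "(\<lambda>t. rhs (w t)) \<in> {0<..T} \<rightarrow> E"
      using u(2) w by (auto intro: rhs_in_E)
    show "(w has_vector_derivative rhs (w t)) (at t within {0..T})"
      and "rhs (w t) = A (w t) - m *\<^sub>R w t - w t * G (w t)" if "t \<in> {0<..T}" for t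
      using that w_der[of t] by (auto simp: rhs_def)
  qed
  moreover have "\<forall>t\<in>{0..T}. 0 \<le> w t"
    using u(2) w by (auto simp: cone_def)
  ultimately show "\<exists>u. classical_solution E A G m T u0 u \<and> (\<forall>t\<in>{0..T}. 0 \<le> u t)"
    by blast
qed (blast intro: classical_solution_unique)

end

section \<open>Bounded continuous functions\<close>

instance real :: ordered_banach_algebra
  by standard (auto simp: closed_Collect_le)

instance bcontfun :: (metric_space, banach) banach ..

lemma less_eq_bcontfun_iff: "f \<le> g \<longleftrightarrow> (\<forall>x. apply_bcontfun f x \<le> apply_bcontfun g x)"
  by (rule less_eq_bcontfun.rep_eq)

instance bcontfun :: (metric_space, ordered_banach_algebra) ordered_banach_algebra
proof
  fix f g h :: "'a \<Rightarrow>\<^sub>C 'b" and a b :: real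
  show "h + f \<le> h + g" if "f \<le> g"
    using that by (simp add: less_eq_bcontfun_iff)
  show "a *\<^sub>R f \<le> a *\<^sub>R g" if "f \<le> g" "0 \<le> a"
    using that by (simp add: less_eq_bcontfun_iff scaleR_left_mono)
  show "a *\<^sub>R f \<le> b *\<^sub>R f" if "a \<le> b" "0 \<le> f"
    using that by (simp add: less_eq_bcontfun_iff scaleR_right_mono)
  show "0 \<le> f * g" if "0 \<le> f" "0 \<le> g"
    using that by (simp add: less_eq_bcontfun_iff times_bcontfun.rep_eq mult_nonneg_nonneg_oba)
  show "f \<le> norm f *\<^sub>R 1"
    unfolding less_eq_bcontfun_iff
  proof
    fix x
    have "apply_bcontfun f x \<le> norm (apply_bcontfun f x) *\<^sub>R 1"
      by (rule le_norm_scaleR_one)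
    also have "\<dots> \<le> norm f *\<^sub>R (1 :: 'b)"
      by (intro scaleR_right_mono norm_bounded zero_le_one_oba)
    finally show "apply_bcontfun f x \<le> apply_bcontfun (norm f *\<^sub>R 1) x"
      by (simp add: one_bcontfun.rep_eq)
  qed
  show "norm f \<le> norm g" if "0 \<le> f" "f \<le> g"
  proof (rule norm_bound)
    fix x
    have "norm (apply_bcontfun f x) \<le> norm (apply_bcontfun g x)"
      using that by (intro norm_mono_nonneg) (simp_all add: less_eq_bcontfun_iff)
    then show "norm (apply_bcontfun f x) \<le> norm g"
      using norm_bounded order_trans by blast
  qed
  have "{f :: 'a \<Rightarrow>\<^sub>C 'b. 0 \<le> f} = PiC UNIV (\<lambda>_. {x. 0 \<le> x})"
    by (auto simp: less_eq_bcontfun_iff mem_PiC_iff Pi_def)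
  then show "closed {f :: 'a \<Rightarrow>\<^sub>C 'b. 0 \<le> f}"
    by (simp add: closed_PiC closed_nonneg_cone)
qed


lemma C_ub_modulus:
  assumes "f \<in> C_ub" "e > 0"
  shows "\<exists>d>0. \<forall>x y. dist y x < d \<longrightarrow> dist (apply_bcontfun f y) (apply_bcontfun f x) < e"
  using assms by (simp add: C_ub_def uniformly_continuous_on_def)

lemma closed_C_ub: "closed (C_ub :: ('a::euclidean_space \<Rightarrow>\<^sub>C real) set)"
  unfolding closed_sequential_limits
proof safe
  fix f :: "nat \<Rightarrow> 'a \<Rightarrow>\<^sub>C real" and l
  assume f: "\<forall>n. f n \<in> C_ub" and l: "f \<longlonglongrightarrow> l"
  show "l \<in> C_ub"
    unfolding C_ub_def mem_Collect_eq uniformly_continuous_on_def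
  proof (intro allI impI)
    fix e :: real assume "e > 0"
    then obtain n where n: "dist (f n) l < e / 3"
      using metric_LIMSEQ_D[OF l, of "e/3"] by auto
    have "f n \<in> C_ub" and "e / 3 > 0"
      using f \<open>e > 0\<close> by simp_all
    from C_ub_modulus[OF this]
    obtain d where d: "d > 0" "\<And>x y. dist y x < d \<Longrightarrow> dist (f n y) (f n x) < e / 3"
      by blast
    have "dist (l y) (l x) < e" if "dist y x < d" for x y
      using d(2)[OF that] dist_bounded[of "f n" x l] dist_bounded[of "f n" y l] n
      unfolding dist_real_def by linarith
    with d(1) show "\<exists>d>0. \<forall>x\<in>UNIV. \<forall>y\<in>UNIV. dist y x < d \<longrightarrow> dist (l y) (l x) < e"
      by blast
  qed
qed

lemma subspace_C_ub: "subspace (C_ub :: ('a::euclidean_space \<Rightarrow>\<^sub>C real) set)"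
  unfolding C_ub_def subspace_def
  by (auto simp del: real_scaleR_def intro!: uniformly_continuous_on_add uniformly_continuous_on_const
      uniformly_continuous_on_cmul)

lemma C_ub_mult:
  fixes f g :: "'a::euclidean_space \<Rightarrow>\<^sub>C real"
  assumes "f \<in> C_ub" "g \<in> C_ub"
  shows "f * g \<in> C_ub"
  unfolding C_ub_def mem_Collect_eq times_bcontfun.rep_eq
  unfolding uniformly_continuous_on_def
proof (intro allI impI)
  fix e :: real assume "e > 0"
  define B where "B = norm f + norm g + 1"
  have B: "B > 0" "norm f \<le> B" "norm g \<le> B"
    by (simp_all add: B_def add_nonneg_pos)
  with \<open>e > 0\<close> have "e / (2 * B) > 0" by simp
  from C_ub_modulus[OF assms(1) this] C_ub_modulus[OF assms(2) this]
  obtain d1 d2 where d: "d1 > 0" "\<And>x y. dist y x < d1 \<Longrightarrow> dist (f y) (f x) < e / (2 * B)"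
      "d2 > 0" "\<And>x y. dist y x < d2 \<Longrightarrow> dist (g y) (g x) < e / (2 * B)"
    by blast
  have "dist (f y * g y) (f x * g x) < e" if "dist y x < min d1 d2" for x y
  proof -
    have *: "\<bar>f y - f x\<bar> < e / (2 * B)" "\<bar>g y - g x\<bar> < e / (2 * B)"
      using d(2)[of y x] d(4)[of y x] that by (auto simp: dist_real_def)
    have "\<bar>f y * g y - f x * g x\<bar> = \<bar>f y * (g y - g x) + (f y - f x) * g x\<bar>"
      by (simp add: algebra_simps)
    also have "\<dots> \<le> \<bar>f y\<bar> * \<bar>g y - g x\<bar> + \<bar>f y - f x\<bar> * \<bar>g x\<bar>"
      by (metis abs_mult abs_triangle_ineq)
    also have "\<dots> \<le> B * \<bar>g y - g x\<bar> + \<bar>f y - f x\<bar> * B"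
      using norm_bounded[of f y] norm_bounded[of g x] B
      by (intro add_mono mult_right_mono mult_left_mono) auto
    also have "\<dots> < B * (e / (2 * B)) + e / (2 * B) * B"
      using * B by (intro add_strict_mono mult_strict_left_mono mult_strict_right_mono) auto
    also have "\<dots> = e" using B by simp
    finally show ?thesis by (simp add: dist_real_def)
  qed
  with d show "\<exists>d>0. \<forall>x\<in>UNIV. \<forall>y\<in>UNIV. dist y x < d \<longrightarrow> dist (f y * g y) (f x * g x) < e"
    by (intro exI[of _ "min d1 d2"]) auto
qed

section \<open>Essentially bounded functions\<close>

text \<open>
  Elements of \<open>L\<^sup>\<infinity>\<close> are handled through the representatives \<open>rep_linf\<close>, on which the operations act
  pointwise almost everywhere.
\<close>

lemma ess_bounded_rep_linf: "ess_bounded (rep_linf v)"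
  using Quotient_rep_reflp[OF Quotient_linf, of v] by (simp add: linf_rel_def)

lemma abs_linf_rep: "abs_linf (rep_linf v) = v"
  by (rule Quotient_abs_rep[OF Quotient_linf])

lemma rep_abs_linf:
  assumes "ess_bounded f"
  shows "AE x in lebesgue. rep_linf (abs_linf f) x = f x"
  using Quotient_rep_abs[OF Quotient_linf, of f] assms by (auto simp: linf_rel_def)

lemma rep_linf_diff: "AE x in lebesgue. rep_linf (v - w) x = rep_linf v x - rep_linf w x"
  using rep_abs_linf[OF ess_bounded_diff[OF ess_bounded_rep_linf[of v] ess_bounded_rep_linf[of w]]]
  by (simp add: minus_linf_def)

lemma norm_linf_eq: "norm v = real_of_ereal (ess_norm (rep_linf v))"
  by (rule norm_linf.rep_eq)

lemma AE_le_norm_linf: "AE x in lebesgue. \<bar>rep_linf v x\<bar> \<le> norm v"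
  unfolding norm_linf_eq by (rule ess_bounded_AE[OF ess_bounded_rep_linf])

lemma norm_linf_leI: "AE x in lebesgue. \<bar>rep_linf v x\<bar> \<le> c \<Longrightarrow> norm v \<le> c"
  unfolding norm_linf_eq by (intro real_ess_norm_le ess_bounded_measurable ess_bounded_rep_linf)

lemma less_eq_linf_iff: "v \<le> w \<longleftrightarrow> (AE x in lebesgue. rep_linf v x \<le> rep_linf w x)"
  by (rule less_eq_linf.rep_eq)

text \<open>
  For a Cauchy sequence, countably many null sets can be discarded at once, and off their union the
  representatives form a uniformly Cauchy sequence of functions. Their pointwise limit represents the limit.
\<close>

instance linf :: (euclidean_space) banach
proof
  fix X :: "nat \<Rightarrow> 'a linf" assume X: "Cauchy X"
  define R where "R n = rep_linf (X n)" for n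
  define f where "f x = lim (\<lambda>n. R n x)" for x
  have [measurable]: "R n \<in> borel_measurable lebesgue" for n
    unfolding R_def by (intro ess_bounded_measurable ess_bounded_rep_linf)
  have f_meas: "f \<in> borel_measurable lebesgue"
    unfolding f_def by measurable
  have diff: "AE x in lebesgue. \<forall>n k. \<bar>R n x - R k x\<bar> \<le> norm (X n - X k)"
    unfolding AE_all_countable R_def
  proof (intro allI)
    fix n k
    show "AE x in lebesgue. \<bar>rep_linf (X n) x - rep_linf (X k) x\<bar> \<le> norm (X n - X k)"
      using rep_linf_diff[of "X n" "X k"] AE_le_norm_linf[of "X n - X k"]
      by eventually_elim simp
  qed
  have close: "\<exists>N. \<forall>n\<ge>N. AE x in lebesgue. \<bar>R n x - f x\<bar> \<le> e" if "e > 0" for e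
  proof -
    obtain N where N: "\<And>n k. n \<ge> N \<Longrightarrow> k \<ge> N \<Longrightarrow> norm (X n - X k) < e"
      using CauchyD[OF X \<open>e > 0\<close>] by blast
    have "AE x in lebesgue. \<bar>R n x - f x\<bar> \<le> e" if "n \<ge> N" for n
      using diff
    proof eventually_elim
      case (elim x)
      have "Cauchy (\<lambda>n. R n x)"
      proof (rule CauchyI)
        fix d :: real assume "d > 0"
        from CauchyD[OF X this] obtain M where "\<forall>m\<ge>M. \<forall>n\<ge>M. norm (X m - X n) < d"
          by blast
        then show "\<exists>M. \<forall>m\<ge>M. \<forall>n\<ge>M. norm (R m x - R n x) < d"
          unfolding real_norm_def using elim by (meson le_less_trans)
      qed
      then have "(\<lambda>k. R k x) \<longlonglongrightarrow> f x"
        unfolding f_def by (simp add: Cauchy_convergent_iff convergent_LIMSEQ_iff)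
      then have "(\<lambda>k. \<bar>R n x - R k x\<bar>) \<longlonglongrightarrow> \<bar>R n x - f x\<bar>"
        by (intro tendsto_intros)
      moreover have "\<bar>R n x - R k x\<bar> \<le> e" if "k \<ge> N" for k
        using N[OF \<open>n \<ge> N\<close> that] elim[rule_format, of n k] by linarith
      ultimately show ?case
        by (intro LIMSEQ_le_const2) auto
    qed
    then show ?thesis by blast
  qed
  obtain N where N: "AE x in lebesgue. \<bar>R N x - f x\<bar> \<le> 1"
    using close[of 1] by auto
  have "AE x in lebesgue. \<bar>f x\<bar> \<le> norm (X N) + 1"
    using N AE_le_norm_linf[of "X N"] by eventually_elim (auto simp: R_def)
  with f_meas have f_bd: "ess_bounded f" by (rule ess_boundedI)
  have "X \<longlonglongrightarrow> abs_linf f"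
  proof (rule LIMSEQ_I)
    fix e :: real assume "e > 0"
    then obtain M where M: "\<And>n. n \<ge> M \<Longrightarrow> AE x in lebesgue. \<bar>R n x - f x\<bar> \<le> e / 2"
      using close[of "e/2"] by auto
    have "norm (X n - abs_linf f) < e" if "n \<ge> M" for n
    proof -
      have "norm (X n - abs_linf f) \<le> e / 2"
      proof (rule norm_linf_leI)
        show "AE x in lebesgue. \<bar>rep_linf (X n - abs_linf f) x\<bar> \<le> e / 2"
          using rep_linf_diff[of "X n" "abs_linf f"] rep_abs_linf[OF f_bd] M[OF that]
          by eventually_elim (simp add: R_def)
      qed
      with \<open>e > 0\<close> show ?thesis by simp
    qed
    then show "\<exists>M. \<forall>n\<ge>M. norm (X n - abs_linf f) < e" by blast
  qed
  then show "convergent X" by (rule convergentI)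
qed

instance linf :: (euclidean_space) ordered_banach_algebra
proof
  fix f g h :: "'a linf" and a b :: real
  show "h + f \<le> h + g" if "f \<le> g"
    using that by transfer simp
  show "a *\<^sub>R f \<le> a *\<^sub>R g" if "f \<le> g" "0 \<le> a"
    using that by transfer (auto elim!: eventually_mono intro: mult_left_mono)
  show "a *\<^sub>R f \<le> b *\<^sub>R f" if "a \<le> b" "0 \<le> f"
    using that by transfer (auto elim!: eventually_mono intro: mult_right_mono)
  show "0 \<le> f * g" if "0 \<le> f" "0 \<le> g"
    using that by transfer (auto elim: eventually_elim2)
  show "f \<le> norm f *\<^sub>R 1"
  proof transfer
    fix f :: "'a \<Rightarrow> real" assume "linf_rel f f"
    then have "ess_bounded f" by (simp add: linf_rel_def)
    from ess_bounded_AE[OF this]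
    show "AE x in lebesgue. f x \<le> real_of_ereal (ess_norm f) * 1"
      by eventually_elim simp
  qed
  show "norm f \<le> norm g" if "0 \<le> f" "f \<le> g"
    using that
  proof transfer
    fix f g :: "'a \<Rightarrow> real" 
    assume "linf_rel f f" "linf_rel g g" and le: "AE x in lebesgue. 0 \<le> f x" "AE x in lebesgue. f x \<le> g x"
    then have f: "ess_bounded f" and g: "ess_bounded g" by (auto simp: linf_rel_def)
    show "real_of_ereal (ess_norm f) \<le> real_of_ereal (ess_norm g)"
    proof (rule real_ess_norm_le[OF ess_bounded_measurable[OF f]])
      show "AE x in lebesgue. \<bar>f x\<bar> \<le> real_of_ereal (ess_norm g)"
        using le ess_bounded_AE[OF g] by eventually_elim linarith
    qed
  qed
  show "closed {f :: 'a linf. 0 \<le> f}"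
    unfolding closed_sequential_limits
  proof safe
    fix X and l :: "'a linf"
    assume X: "\<forall>n. X n \<in> {f. 0 \<le> f}" and l: "X \<longlonglongrightarrow> l"
    have "AE x in lebesgue. \<forall>n. 0 \<le> rep_linf (X n) x \<and> \<bar>rep_linf (X n) x - rep_linf l x\<bar> \<le> norm (X n - l)"
      unfolding AE_all_countable
    proof
      fix n
      have "AE x in lebesgue. rep_linf (0 :: 'a linf) x = 0"
        unfolding zero_linf_def by (intro rep_abs_linf ess_bounded_const)
      moreover have "AE x in lebesgue. rep_linf 0 x \<le> rep_linf (X n) x"
        using X by (simp add: less_eq_linf_iff)
      ultimately show "AE x in lebesgue. 0 \<le> rep_linf (X n) x \<and> \<bar>rep_linf (X n) x - rep_linf l x\<bar> \<le> norm (X n - l)"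
        using AE_le_norm_linf[of "X n - l"] rep_linf_diff[of "X n" l] by eventually_elim auto
    qed
    then have "AE x in lebesgue. 0 \<le> rep_linf l x"
    proof eventually_elim
      case (elim x)
      have "(\<lambda>n. norm (X n - l)) \<longlonglongrightarrow> 0"
        using l by (simp add: LIM_zero tendsto_norm_zero)
      then have "(\<lambda>n. - norm (X n - l)) \<longlonglongrightarrow> 0"
        using tendsto_minus by fastforce
      moreover have "- norm (X n - l) \<le> rep_linf l x" for n
        using elim[rule_format, of n] by linarith
      ultimately show ?case
        by (intro LIMSEQ_le_const2) auto
    qed
    moreover have "AE x in lebesgue. rep_linf (0 :: 'a linf) x = 0"
      unfolding zero_linf_def by (intro rep_abs_linf ess_bounded_const)
    ultimately show "0 \<le> l"
      unfolding less_eq_linf_iff by eventually_elim simp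
  qed
qed

section \<open>The three function spaces\<close>

theorem theorem3p3:
  fixes m \<kappa> K T :: real
  assumes "m > 0" and "\<kappa> > 0" and "K > 0" and "T > 0"
  shows
    "(\<forall>A G. admissible_operators (C_ub :: ((real ^ 'd) \<Rightarrow>\<^sub>C real) set) \<kappa> K A G \<longrightarrow>
        (\<forall>u0\<in>C_ub. 0 \<le> u0 \<longrightarrow> (\<exists>!u. classical_solution C_ub A G m T u0 u \<and> (\<forall>t\<in>{0..T}. 0 \<le> u t)))) \<and>
     (\<forall>A G. admissible_operators (C_b :: ((real ^ 'd) \<Rightarrow>\<^sub>C real) set) \<kappa> K A G \<longrightarrow>
        (\<forall>u0\<in>C_b. 0 \<le> u0 \<longrightarrow> (\<exists>!u. classical_solution C_b A G m T u0 u \<and> (\<forall>t\<in>{0..T}. 0 \<le> u t)))) \<and>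
     (\<forall>A G. admissible_operators (L_infinity :: (real ^ 'd) linf set) \<kappa> K A G \<longrightarrow>
        (\<forall>u0\<in>L_infinity. 0 \<le> u0 \<longrightarrow> (\<exists>!u. classical_solution L_infinity A G m T u0 u \<and> (\<forall>t\<in>{0..T}. 0 \<le> u t))))"
proof (intro conjI allI impI ballI)
  fix A G :: "((real ^ 'd) \<Rightarrow>\<^sub>C real) \<Rightarrow> ((real ^ 'd) \<Rightarrow>\<^sub>C real)" and u0 :: "(real ^ 'd) \<Rightarrow>\<^sub>C real"
  assume "admissible_operators C_ub \<kappa> K A G" and u0: "u0 \<in> C_ub" "0 \<le> u0"
  then interpret positive_evolution C_ub A G m \<kappa> K
    using assms by unfold_locales (auto intro: closed_C_ub subspace_C_ub C_ub_mult)
  show "\<exists>!u. classical_solution C_ub A G m T u0 u \<and> (\<forall>t\<in>{0..T}. 0 \<le> u t)"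
    by (rule ex1_nonneg_classical_solution[OF \<open>T > 0\<close> u0])
next
  fix A G :: "((real ^ 'd) \<Rightarrow>\<^sub>C real) \<Rightarrow> ((real ^ 'd) \<Rightarrow>\<^sub>C real)" and u0 :: "(real ^ 'd) \<Rightarrow>\<^sub>C real"
  assume "admissible_operators C_b \<kappa> K A G" and u0: "u0 \<in> C_b" "0 \<le> u0"
  then interpret positive_evolution C_b A G m \<kappa> K
    using assms by unfold_locales (auto simp: C_b_def)
  show "\<exists>!u. classical_solution C_b A G m T u0 u \<and> (\<forall>t\<in>{0..T}. 0 \<le> u t)"
    by (rule ex1_nonneg_classical_solution[OF \<open>T > 0\<close> u0])
next
  fix A G :: "(real ^ 'd) linf \<Rightarrow> (real ^ 'd) linf" and u0 :: "(real ^ 'd) linf"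
  assume "admissible_operators L_infinity \<kappa> K A G" and u0: "u0 \<in> L_infinity" "0 \<le> u0"
  then interpret positive_evolution L_infinity A G m \<kappa> K
    using assms by unfold_locales (auto simp: L_infinity_def)
  show "\<exists>!u. classical_solution L_infinity A G m T u0 u \<and> (\<forall>t\<in>{0..T}. 0 \<le> u t)"
    by (rule ex1_nonneg_classical_solution[OF \<open>T > 0\<close> u0])
qed

end
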